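(* There exist infinitely many natural numbers $n$ which cannot be written as $n = z + p$ with $z$ a Zumkeller number and $p$ a prime.
   Context: A natural number $n$ is a Zumkeller number if the set of its positive divisors can be partitioned into two subsets with equal sums. *)

theory Defs
  imports "HOL-Computational_Algebra.Primes"
begin

(* Positivity matters: every natural number divides 0, and sums over infinite sets are 0. *)
definition zumkeller :: "nat \<Rightarrow> bool" where
  "zumkeller n \<longleftrightarrow> n > 0 \<and>
     (\<exists>A B. A \<union> B = {d. d dvd n} \<and> A \<inter> B = {} \<and> \<Sum>A = \<Sum>B)"

end

theory Submission
  imports Defs Complex_Main "HOL-Library.Infinite_Set"
begin

text \<open>
  A Zumkeller number \<open>z\<close> satisfies \<open>\<sigma>(z) \<ge> 2 z\<close>. Let \<open>n\<close> be twice the product of all primes up to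
  \<open>y\<close>, and suppose \<open>n = z + p\<close>. A prime \<open>q \<le> y\<close> dividing \<open>z\<close> divides \<open>p\<close> too, so \<open>z = p\<^sup>a m\<close> where all
  prime factors of \<open>m\<close> exceed \<open>y\<close>. Since \<open>4\<close> divides \<open>n\<close>, the exponent is at most \<open>1\<close> if \<open>p = 2\<close>, so
  \<open>\<sigma>(p\<^sup>a) \<le> 3/2 p\<^sup>a\<close> in all cases. As \<open>m < n \<le> 2 y\<^sup>r\<close> with \<open>r = \<pi>(y)\<close>, the number \<open>m\<close> has at most \<open>r\<close>
  prime factors, whence \<open>\<sigma>(m) \<le> (1 + 1/y)\<^sup>r m \<le> exp (r/y) m\<close>. Primes are coprime to \<open>30\<close> with three
  exceptions, so \<open>r/y\<close> is asymptotically at most \<open>8/30 < ln (4/3)\<close>, and \<open>\<sigma>(z) < 2 z\<close> follows.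
\<close>

definition divisor_sum :: "nat \<Rightarrow> nat" where
  "divisor_sum n = \<Sum>{d. d dvd n}"

text \<open>One of the two parts contains \<open>z\<close> itself, so both of the equal sums are at
  least \<open>z\<close>.\<close>

lemma zumkeller_imp_divisor_sum_ge:
  assumes "zumkeller z"
  shows "2 * z \<le> divisor_sum z"
proof -
  from assms obtain A B where z: "z > 0" and AB: "A \<union> B = {d. d dvd z}" "A \<inter> B = {}"
    and eq: "\<Sum>A = \<Sum>B"
    by (auto simp: zumkeller_def)
  have fin: "finite A" "finite B"
    using AB(1) finite_divisors_nat[OF z] by (metis finite_Un)+
  have "divisor_sum z = \<Sum>A + \<Sum>B"
    unfolding divisor_sum_def AB(1)[symmetric] by (rule sum.union_disjoint[OF fin AB(2)])
  moreover have "z \<in> A \<or> z \<in> B"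
    using AB(1) by auto
  then have "z \<le> \<Sum>A \<or> z \<le> \<Sum>B"
    using fin by (metis member_le_sum zero_le)
  ultimately show ?thesis
    using eq by auto
qed

text \<open>Every divisor of \<open>a * b\<close> is a divisor of \<open>a\<close> times a divisor
  of \<open>b\<close>; products that coincide only enlarge the right-hand side.\<close>

lemma divisor_sum_mult_le:
  assumes "a > 0" "b > 0"
  shows "divisor_sum (a * b) \<le> divisor_sum a * divisor_sum b"
proof -
  let ?D = "{d. d dvd a} \<times> {d. d dvd b}"
  have fin: "finite ?D"
    using assms by (simp add: finite_divisors_nat)
  have "{d. d dvd a * b} \<subseteq> (\<lambda>(x, y). x * y) ` ?D"
    by (force elim: dvd_productE)
  then have "divisor_sum (a * b) \<le> \<Sum>((\<lambda>(x, y). x * y) ` ?D)"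
    unfolding divisor_sum_def using fin by (intro sum_mono2) auto
  also have "\<dots> \<le> (\<Sum>(x, y)\<in>?D. x * y)"
    using sum_image_le[OF fin, of "\<lambda>x. x" "\<lambda>(x, y). x * y"] by (simp add: case_prod_unfold)
  also have "\<dots> = divisor_sum a * divisor_sum b"
    unfolding divisor_sum_def by (simp add: sum_product sum.cartesian_product)
  finally show ?thesis .
qed

lemma divisor_sum_1: "divisor_sum 1 = 1"
  by (simp add: divisor_sum_def)

lemma divisor_sum_prime:
  assumes "prime p"
  shows "divisor_sum p = p + 1"
proof -
  have "{d. d dvd p} = {1, p}"
    using assms by (auto simp: prime_nat_iff)
  then show ?thesis
    using prime_gt_1_nat[OF assms] by (simp add: divisor_sum_def)
qed

lemma divisor_sum_odd_prime_power_less: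
  assumes p: "prime p" "p \<noteq> 2"
  shows "2 * divisor_sum (p ^ a) < 3 * p ^ a"
proof (induction a)
  case 0
  then show ?case
    using divisor_sum_1 by simp
next
  case (Suc a)
  have p3: "p \<ge> 3"
    using prime_ge_2_nat[OF p(1)] p(2) by linarith
  have "{d. d dvd p ^ Suc a} = insert (p ^ Suc a) {d. d dvd p ^ a}"
    unfolding divides_primepow_nat[OF p(1)] by (auto simp: le_Suc_eq)
  then have "divisor_sum (p ^ Suc a) \<le> p ^ Suc a + divisor_sum (p ^ a)"
    unfolding divisor_sum_def using p3 by (auto simp: sum.insert_if finite_divisors_nat)
  moreover have "3 * p ^ a \<le> p ^ Suc a"
    using p3 by simp
  ultimately show ?case
    using Suc.IH by linarith
qed

text \<open>The witness \<open>k\<close> counts prime factors with multiplicity. Removing a prime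
  \<open>q > y\<close> divides \<open>m\<close> by at least \<open>y + 1\<close> and the ratio
  \<open>divisor_sum m / m\<close> by at most \<open>1 + 1 / q\<close>.\<close>

lemma divisor_sum_le_of_large_prime_factors:
  fixes y m :: nat
  assumes "y > 0" "m > 0" "\<And>q. prime q \<Longrightarrow> q dvd m \<Longrightarrow> y < q"
  shows "\<exists>k. (y + 1) ^ k \<le> m \<and> real (divisor_sum m) \<le> (1 + 1 / y) ^ k * m"
  using assms(2,3)
proof (induction m rule: less_induct)
  case (less m)
  show ?case
  proof (cases "m = 1")
    case True
    then show ?thesis
      using divisor_sum_1 by (intro exI[of _ 0]) simp
  next
    case False
    then obtain q where q: "prime q" "q dvd m"
      using prime_factor_nat by blast
    then obtain l where l: "m = q * l"
      by blast
    have yq: "y < q"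
      using less.prems(2) q by blast
    have "l > 0" "l < m"
      using less.prems(1) prime_gt_1_nat[OF q(1)] l by auto
    then obtain k where k: "(y + 1) ^ k \<le> l" "real (divisor_sum l) \<le> (1 + 1 / y) ^ k * l"
      using less.IH[of l] less.prems(2) l by auto
    have "(y + 1) ^ Suc k \<le> m"
      using mult_mono[of "y + 1" q, OF _ k(1)] yq l by simp
    moreover have "real (divisor_sum m) \<le> (1 + 1 / y) ^ Suc k * m"
    proof -
      have "real (divisor_sum m) \<le> real (q + 1) * real (divisor_sum l)"
        using divisor_sum_mult_le[of q l] \<open>l > 0\<close> yq divisor_sum_prime[OF q(1)]
        unfolding l of_nat_mult[symmetric] of_nat_le_iff by simp
      also have "\<dots> \<le> ((1 + 1 / y) * q) * ((1 + 1 / y) ^ k * l)"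
        using assms(1) yq k(2) by (intro mult_mono) (auto simp: field_simps)
      finally show ?thesis
        by (simp add: l mult_ac)
    qed
    ultimately show ?thesis
      by blast
  qed
qed

text \<open>Apart from 2, 3 and 5, a prime lies in one of the 8 residue classes coprime to 30, and
  each of the \<open>t\<close> blocks of length 30 meets each class once.\<close>

lemma card_primes_le_multiple_of_30:
  "card {p::nat. prime p \<and> p \<le> 30 * t} \<le> 8 * t + 3"
proof -
  let ?C = "{1, 7, 11, 13, 17, 19, 23, 29} :: nat set"
  have sub: "{p. prime p \<and> p \<le> 30 * t} \<subseteq> {2, 3, 5} \<union> (\<lambda>(j, c). 30 * j + c) ` ({..<t} \<times> ?C)"
  proof
    fix p :: nat
    assume "p \<in> {p. prime p \<and> p \<le> 30 * t}"
    then have p: "prime p" "p \<le> 30 * t"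
      by auto
    show "p \<in> {2, 3, 5} \<union> (\<lambda>(j, c). 30 * j + c) ` ({..<t} \<times> ?C)"
    proof (cases "p \<in> {2, 3, 5}")
      case False
      have dvd: "d dvd p \<Longrightarrow> d = 1 \<or> d = p" for d
        using p(1) by (auto simp: prime_nat_iff)
      have nd: "\<not> 2 dvd p" "\<not> 3 dvd p" "\<not> 5 dvd p"
        using dvd[of 2] dvd[of 3] dvd[of 5] False by auto
      then have "p mod 30 \<in> ?C"
        unfolding insert_iff empty_iff by presburger
      \<comment> \<open>Excluding the right endpoint keeps the quotient strictly below
        \<open>t\<close>, so that no extra block is counted.\<close>
      moreover have "p \<noteq> 30 * t"
        using nd(1) by auto
      then have "p div 30 < t"
        using p(2) by auto
      ultimately show ?thesis
        by (intro UnI2 image_eqI[of _ _ "(p div 30, p mod 30)"]) auto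
    qed auto
  qed
  have "card {p. prime p \<and> p \<le> 30 * t}
      \<le> card ({2, 3, 5} \<union> (\<lambda>(j, c). 30 * j + c) ` ({..<t} \<times> ?C))"
    using sub by (intro card_mono) auto
  also have "\<dots> \<le> card {2, 3, 5 :: nat} + card ({..<t} \<times> ?C)"
    by (intro order.trans[OF card_Un_le] add_mono card_image_le) auto
  also have "\<dots> = 8 * t + 3"
    by simp
  finally show ?thesis .
qed

text \<open>The constant \<open>28 / 100\<close> lies below \<open>ln (4 / 3)\<close> and above
  \<open>8 / 30\<close>, which leaves room for the three exceptional primes.\<close>

lemma power_one_plus_inverse_less:
  fixes y k :: nat
  assumes "y > 0" "real k \<le> 28 / 100 * y"
  shows "(1 + 1 / real y) ^ k < 4 / 3"
proof -
  have "(1 + 1 / real y) ^ k \<le> exp (1 / y) ^ k"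
    using exp_ge_add_one_self by (intro power_mono) auto
  also have "\<dots> = exp (k / y)"
    by (simp add: exp_of_nat_mult[symmetric])
  also have "\<dots> \<le> exp (28 / 100)"
    using assms by (simp add: field_simps)
  \<comment> \<open>\<open>1 + x \<le> exp x\<close> is sharp enough only after splitting the exponent into eight parts.\<close>
  also have "\<dots> = 1 / exp (- 35 / 1000) ^ 8"
    by (simp add: exp_of_nat_mult[symmetric] exp_minus field_simps)
  also have "\<dots> \<le> 1 / (965 / 1000) ^ 8"
    using exp_ge_add_one_self[of "- 35 / 1000"]
    by (intro divide_left_mono power_mono mult_pos_pos) auto
  also have "\<dots> < 4 / 3"
    by (simp add: field_simps)
  finally show ?thesis .
qed

text \<open>The extra factor 2 gives divisibility by 4, which limits the power of 2 in
  \<open>z\<close> when \<open>p = 2\<close>.\<close>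

definition twice_primorial :: "nat \<Rightarrow> nat" where
  "twice_primorial y = 2 * \<Prod>{p. prime p \<and> p \<le> y}"

lemma prime_dvd_twice_primorial:
  assumes "prime q" "q \<le> y"
  shows "q dvd twice_primorial y"
  unfolding twice_primorial_def using assms by (intro dvd_mult dvd_prodI[of _ _ "\<lambda>x. x"]) auto

lemma twice_primorial_pos: "twice_primorial y > 0"
  unfolding twice_primorial_def by (auto intro!: prod_pos prime_gt_0_nat)

lemma four_dvd_twice_primorial:
  assumes "y \<ge> 2"
  shows "4 dvd twice_primorial y"
proof -
  have "2 dvd \<Prod>{p. prime p \<and> p \<le> y}"
    using assms by (intro dvd_prodI[of _ _ "\<lambda>x. x"]) auto
  then show ?thesis
    unfolding twice_primorial_def by auto
qed

lemma twice_primorial_le: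
  "twice_primorial y \<le> 2 * y ^ card {p. prime p \<and> p \<le> y}"
  unfolding twice_primorial_def
  using prod_mono[of "{p. prime p \<and> p \<le> y}" "\<lambda>x. x" "\<lambda>_. y"] by auto

lemma divisor_sum_twice_primorial_minus_prime_less:
  assumes t: "t \<ge> 8" and p: "prime p" and n: "twice_primorial (30 * t) = z + p" and z: "z > 0"
  shows "divisor_sum z < 2 * z"
proof -
  define y where "y = 30 * t"
  define r where "r = card {p::nat. prime p \<and> p \<le> y}"
  have y: "y > 2"
    using t by (simp add: y_def)
  obtain a m where am: "z = p ^ a * m" "\<not> p dvd m"
    using multiplicity_decompose'[of z p] z p
    by (metis not_prime_unit mult.commute less_numeral_extra(3))
  have m: "m > 0" "m \<le> z"
    using z am prime_gt_0_nat[OF p] by auto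
  have "y < q" if q: "prime q" "q dvd m" for q
  proof (rule ccontr)
    assume "\<not> y < q"
    then have "q dvd z + p"
      using prime_dvd_twice_primorial[OF q(1), of y] n y_def by simp
    moreover have "q dvd z"
      using q(2) am(1) by simp
    ultimately have "q = p"
      using p q(1) by (simp add: dvd_add_right_iff primes_dvd_imp_eq)
    then show False
      using am(2) q(2) by simp
  qed
  then obtain k where k: "(y + 1) ^ k \<le> m" "real (divisor_sum m) \<le> (1 + 1 / y) ^ k * m"
    using divisor_sum_le_of_large_prime_factors[of y m] y m by auto
  have "(y + 1) ^ k < 2 * y ^ r"
    using k(1) m(2) n prime_gt_0_nat[OF p] twice_primorial_le[of y] by (simp add: y_def r_def)
  \<comment> \<open>The factor 2 is absorbed into one more power of \<open>y + 1\<close>; strictness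
    then still yields \<open>k \<le> r\<close>.\<close>
  also have "\<dots> \<le> (y + 1) * (y + 1) ^ r"
    using y by (intro mult_mono power_mono) auto
  finally have "(y + 1) ^ k < (y + 1) ^ Suc r"
    by simp
  then have "k \<le> r"
    using y by (subst (asm) power_strict_increasing_iff) auto
  also have "r \<le> 8 * t + 3"
    unfolding r_def y_def by (rule card_primes_le_multiple_of_30)
  \<comment> \<open>Here \<open>8 * t + 3\<close> must not exceed \<open>8.4 * t\<close>, that is,
    \<open>t \<ge> 7.5\<close>; hence the assumption \<open>t \<ge> 8\<close>.\<close>
  finally have "real k \<le> 28 / 100 * y"
    using t by (simp add: y_def)
  then have "(1 + 1 / real y) ^ k * m < 4 / 3 * m"
    using power_one_plus_inverse_less[of y k] y m by (intro mult_strict_right_mono) auto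
  then have sm: "3 * divisor_sum m < 4 * m"
    using k(2) by linarith
  have pa: "2 * divisor_sum (p ^ a) \<le> 3 * p ^ a"
  proof (cases "p = 2")
    case True
    have "4 dvd z + 2"
      using four_dvd_twice_primorial[of y] y n True by (simp add: y_def)
    then have "\<not> 4 dvd z"
      by presburger
    then have "\<not> 2 \<le> a"
      using le_imp_power_dvd[of 2 a "2::nat"] am(1) True by (auto intro: dvd_mult2)
    then have "a = 0 \<or> a = 1"
      by auto
    then show ?thesis
      using divisor_sum_1 divisor_sum_prime[OF p] True by auto
  next
    case False
    then show ?thesis
      using divisor_sum_odd_prime_power_less[OF p] less_imp_le by blast
  qed
  \<comment> \<open>The bounds 3/2 and 4/3 multiply to exactly 2, so the strictness comes from the
    factor \<open>m\<close>.\<close>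
  have "6 * divisor_sum z \<le> (2 * divisor_sum (p ^ a)) * (3 * divisor_sum m)"
    using divisor_sum_mult_le[of "p ^ a" m] m prime_gt_0_nat[OF p] am(1) by simp
  also have "\<dots> \<le> (3 * p ^ a) * (3 * divisor_sum m)"
    using pa by (intro mult_right_mono) auto
  also have "\<dots> < (3 * p ^ a) * (4 * m)"
    using sm prime_gt_0_nat[OF p] by (intro mult_strict_left_mono) auto
  finally show ?thesis
    using am(1) by (simp add: mult_ac)
qed

theorem theorem4p19:
  shows "infinite {n :: nat. \<not> (\<exists>z p :: nat. zumkeller z \<and> prime p \<and> n = z + p)}"
  unfolding infinite_nat_iff_unbounded
proof
  fix N :: nat
  obtain q :: nat where q: "prime q" "q > N"
    using bigger_prime by blast
  \<comment> \<open>The argument exceeds \<open>q\<close>, so \<open>q\<close> divides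
    \<open>n\<close> and \<open>n > N\<close>; the summand 8 secures
    \<open>t \<ge> 8\<close>.\<close>
  define n where "n = twice_primorial (30 * (q + 8))"
  have "q \<le> n"
    unfolding n_def by (rule dvd_imp_le[OF prime_dvd_twice_primorial[OF q(1)] twice_primorial_pos]) simp
  moreover have "\<not> (\<exists>z p. zumkeller z \<and> prime p \<and> n = z + p)"
  proof
    assume "\<exists>z p. zumkeller z \<and> prime p \<and> n = z + p"
    then obtain z p where zp: "zumkeller z" "prime p" "n = z + p"
      by blast
    moreover have "z > 0"
      using zp(1) by (simp add: zumkeller_def)
    ultimately have "divisor_sum z < 2 * z"
      using divisor_sum_twice_primorial_minus_prime_less[of "q + 8" p z] n_def by simp
    then show False
      using zumkeller_imp_divisor_sum_ge[OF zp(1)] by simp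
  qed
  ultimately show "\<exists>n>N. n \<in> {n. \<not> (\<exists>z p. zumkeller z \<and> prime p \<and> n = z + p)}"
    using q(2) by (intro exI[of _ n]) auto
qed

end
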